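(* Let $f:\mathbb{R}^n\to\mathbb{R}^n$ be a function, $F:\mathbb{R}^n\rightrightarrows\mathbb{R}^n$ a set-valued map with closed graph, and $p:[0,1]\to\mathbb{R}^n$ a function. For $t\in[0,1]$ put $G_t(v)=f(v)-p(t)+F(v)$ and $S(t)=\{z\in\mathbb{R}^n : 0\in G_t(z)\}$. Assume that (i) $z:[0,1]\to\mathbb{R}^n$ is a given continuous solution trajectory (that is, $z$ is continuous and $z(t)\in S(t)$ for all $t\in[0,1]$); (ii) $p$ is a Lipschitz continuous function; (iii) for every $t\in[0,1]$, $G_t$ is strongly metrically regular at $z(t)$ for $0$. Then $z(\cdot)$ is a Lipschitz continuous function on $[0,1]$.
   Context: $\mathbb{B}_r(x)$ denotes the closed Euclidean ball of radius $r$ around $x$. $G_t$ is strongly metrically regular at $z(t)$ for $0$ if $0\in G_t(z(t))$ and there exist constants $a_t,b_t,\kappa_t>0$ such that the mapping $\mathbb{B}_{b_t}(0)\ni y\mapsto G_t^{-1}(y)\cap\mathbb{B}_{a_t}(z(t))$ is single-valued (exactly one element for each $y$) and Lipschitz continuous with Lipschitz constant $\kappa_t$. *)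

theory Defs
  imports "HOL-Analysis.Analysis"
begin

text \<open>A set-valued map from \<open>'a\<close> to \<open>'b\<close> is a function \<open>'a \<Rightarrow> 'b set\<close>; empty values are allowed.\<close>

definition graph_of :: "('a \<Rightarrow> 'b set) \<Rightarrow> ('a \<times> 'b) set" where
  "graph_of F = {(x, y). y \<in> F x}"

definition set_inverse :: "('a \<Rightarrow> 'b set) \<Rightarrow> 'b \<Rightarrow> 'a set" where
  "set_inverse F y = {x. y \<in> F x}"

text \<open>The function \<open>s\<close> is the single-valued truncated inverse
  \<open>y \<mapsto> G\<^sup>-\<^sup>1(y) \<inter> B\<^sub>a(x0)\<close> on \<open>B\<^sub>b(y0)\<close>; its values outside \<open>B\<^sub>b(y0)\<close> are irrelevant.\<close>

definition strongly_metrically_regular ::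
  "('a::metric_space \<Rightarrow> 'b::metric_space set) \<Rightarrow> 'a \<Rightarrow> 'b \<Rightarrow> bool" where
  "strongly_metrically_regular G x0 y0 \<longleftrightarrow>
     y0 \<in> G x0 \<and>
     (\<exists>a>0. \<exists>b>0. \<exists>\<kappa>>0. \<exists>s.
        (\<forall>y\<in>cball y0 b. set_inverse G y \<inter> cball x0 a = {s y}) \<and>
        \<kappa>-lipschitz_on (cball y0 b) s)"

definition param_map ::
  "('a \<Rightarrow> 'a) \<Rightarrow> ('a \<Rightarrow> 'a set) \<Rightarrow> (real \<Rightarrow> 'a::real_normed_vector) \<Rightarrow> real \<Rightarrow> 'a \<Rightarrow> 'a set" where
  "param_map f F p t v = (\<lambda>w. f v - p t + w) ` F v"

definition solution_set ::
  "('a \<Rightarrow> 'a) \<Rightarrow> ('a \<Rightarrow> 'a set) \<Rightarrow> (real \<Rightarrow> 'a::real_normed_vector) \<Rightarrow> real \<Rightarrow> 'a set" where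
  "solution_set f F p t = {v. 0 \<in> param_map f F p t v}"

end

theory Submission
  imports Defs
begin

text \<open>Fix \<open>t\<close>. For \<open>r\<close> near \<open>t\<close>, continuity puts \<open>z r\<close> into the ball where \<open>G\<^sub>t\<close> has its
  Lipschitz single-valued inverse \<open>s\<close>, and \<open>0 \<in> G\<^sub>r (z r)\<close> says \<open>p r - p t \<in> G\<^sub>t (z r)\<close>. Hence
  \<open>z r = s (p r - p t)\<close>, so \<open>z\<close> is Lipschitz near \<open>t\<close>. Compactness of \<open>[0,1]\<close> does the rest.\<close>

lemma param_map_shift:
  assumes "v \<in> solution_set f F p r"
  shows "p r - p t \<in> param_map f F p t v"
proof -
  obtain w where "w \<in> F v" "0 = f v - p r + w"
    using assms by (auto simp: solution_set_def param_map_def)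
  then have "p r - p t = f v - p t + w"
    by (simp add: algebra_simps)
  with \<open>w \<in> F v\<close> show ?thesis
    by (auto simp: param_map_def)
qed

text \<open>The constant obtained is \<open>\<kappa> * L\<close>, where \<open>\<kappa>\<close>
  comes from the regularity at \<open>t\<close> and so varies with \<open>t\<close>; hence only a
  local bound results.\<close>

lemma solution_lipschitz_near:
  fixes T :: "real set"
  assumes "t \<in> T" and z_cont: "continuous_on T z" and p_lip: "L-lipschitz_on T p"
    and z_sol: "\<And>r. r \<in> T \<Longrightarrow> z r \<in> solution_set f F p r"
    and regular: "strongly_metrically_regular (param_map f F p t) (z t) 0"
  shows "\<exists>u>0. \<exists>M. M-lipschitz_on (cball t u \<inter> T) z"
proof -
  obtain a b \<kappa> s where "a > 0" "b > 0"
    and s: "\<And>y. y \<in> cball 0 b \<Longrightarrow> set_inverse (param_map f F p t) y \<inter> cball (z t) a = {s y}"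
    and s_lip: "\<kappa>-lipschitz_on (cball 0 b) s"
    using regular unfolding strongly_metrically_regular_def by metis
  obtain d where "d > 0" and d: "\<And>r. r \<in> T \<Longrightarrow> dist r t < d \<Longrightarrow> dist (z r) (z t) < a"
    using z_cont \<open>t \<in> T\<close> \<open>a > 0\<close> unfolding continuous_on_iff by metis
  obtain e where "e > 0" and e: "\<And>r. r \<in> T \<Longrightarrow> dist r t < e \<Longrightarrow> dist (p r) (p t) < b"
    using lipschitz_on_continuous_on[OF p_lip] \<open>t \<in> T\<close> \<open>b > 0\<close>
    unfolding continuous_on_iff by metis
  \<comment> \<open>Halving places the closed ball of radius \<open>u\<close> inside the open balls
    of radii \<open>d\<close> and \<open>e\<close>.\<close>
  define u where "u = min d e / 2"
  have "u > 0" "u < d" "u < e"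
    using \<open>d > 0\<close> \<open>e > 0\<close> by (auto simp: u_def)
  have near: "p r - p t \<in> cball 0 b \<and> s (p r - p t) = z r" if "r \<in> cball t u \<inter> T" for r
  proof -
    have "r \<in> T" "dist r t < d" "dist r t < e"
      using that \<open>u < d\<close> \<open>u < e\<close> by (auto simp: dist_commute)
    then have "p r - p t \<in> cball 0 b" "z r \<in> cball (z t) a"
      using d[of r] e[of r] by (auto simp: dist_norm norm_minus_commute)
    moreover have "z r \<in> set_inverse (param_map f F p t) (p r - p t)"
      using param_map_shift[OF z_sol[OF \<open>r \<in> T\<close>]] by (simp add: set_inverse_def)
    \<comment> \<open>\<open>z r\<close> lies in the truncated inverse at \<open>p r - p t\<close>,
      which is the singleton of \<open>s (p r - p t)\<close>.\<close>
    ultimately show ?thesis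
      using s by (metis IntI singletonD)
  qed
  have "L-lipschitz_on (cball t u \<inter> T) (\<lambda>r. p r - p t)"
    using lipschitz_on_subset[OF p_lip] by (auto simp: lipschitz_on_def dist_norm)
  moreover have "\<kappa>-lipschitz_on ((\<lambda>r. p r - p t) ` (cball t u \<inter> T)) s"
    using lipschitz_on_subset[OF s_lip] near by (meson image_subsetI)
  ultimately have "(\<kappa> * L)-lipschitz_on (cball t u \<inter> T) (s \<circ> (\<lambda>r. p r - p t))"
    by (rule lipschitz_on_compose)
  then have "(\<kappa> * L)-lipschitz_on (cball t u \<inter> T) z"
    by (rule lipschitz_on_transform) (simp add: near)
  with \<open>u > 0\<close> show ?thesis
    by blast
qed

text \<open>If difference quotients were unbounded, boundedness of \<open>g\<close> on
  \<open>X\<close> would force the offending pairs to cluster at one point of \<open>X\<close>,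
  against the local bound there.\<close>

lemma lipschitz_on_compact_if_locally:
  fixes g :: "'a::metric_space \<Rightarrow> 'b::metric_space"
  assumes "compact X" and loc: "\<And>x. x \<in> X \<Longrightarrow> \<exists>u>0. \<exists>M. M-lipschitz_on (cball x u \<inter> X) g"
  shows "\<exists>L. L-lipschitz_on X g"
proof -
  \<comment> \<open>\<open>local_lipschitz\<close> is about families of functions; a one-point
    parameter set turns \<open>g\<close> into one.\<close>
  have "local_lipschitz {0::real} X (\<lambda>_. g)"
    using loc unfolding local_lipschitz_def by blast
  from local_lipschitz_compact_implies_lipschitz[OF this \<open>compact X\<close>] show ?thesis
    by auto
qed

theorem corollary4p6:
  fixes f :: "real ^ 'n \<Rightarrow> real ^ 'n"
    and F :: "real ^ 'n \<Rightarrow> (real ^ 'n) set"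
    and p z :: "real \<Rightarrow> real ^ 'n"
  assumes closed_graph: "closed (graph_of F)"
    and z_cont: "continuous_on {0..1} z"
    and z_sol: "\<And>t. t \<in> {0..1} \<Longrightarrow> z t \<in> solution_set f F p t"
    and p_lipschitz: "\<exists>L. L-lipschitz_on {0..1} p"
    and regular: "\<And>t. t \<in> {0..1} \<Longrightarrow>
                    strongly_metrically_regular (param_map f F p t) (z t) 0"
  shows "\<exists>L. L-lipschitz_on {0..1} z"
proof -
  obtain L where "L-lipschitz_on {0..1} p"
    using p_lipschitz by blast
  from solution_lipschitz_near[OF _ z_cont this z_sol regular] show ?thesis
    by (intro lipschitz_on_compact_if_locally) auto
qed

end
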